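(* Let $\mathbb{F}$ be a field of characteristic zero and let $M$ be a subalgebra of $K_3^{1/2}$. Then: (1) if $\dim(M)=1$, then $M$ is generated by a vector of the form $\gamma_1e+\gamma_2w$, where $\gamma_1,\gamma_2\in\mathbb{F}$; (2) if $\dim(M)=2$, then $M$ is generated by the vectors $e$ and $w$.
   Context: $K_3^{1/2}$ is the superalgebra over $\mathbb{F}$ with even part $\langle e\rangle$, odd part $\langle z,w\rangle$ (so $e,z,w$ is a basis) and multiplication $e^2=e$, $ez=\frac12z+\frac12w$, $ew=\frac12w$, $ze=\frac12z-\frac12w$, $we=\frac12w$, $z^2=-e$, $zw=e$, $wz=-e$, $w^2=0$. A subalgebra is a linear subspace closed under multiplication; it is not required to be spanned by homogeneous elements. *)

theory Defs
  imports "HOL-Analysis.Analysis"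
begin

text \<open>
  The underlying space is the coordinate space \<open>'f ^ 3\<close> over the field \<open>'f\<close>; the constants
  with prefix \<open>vec\<close> are the linear algebra notions for the scalar multiplication \<open>*s\<close> over \<open>'f\<close>.
\<close>

definition K3_e :: "'f::field ^ 3" where "K3_e = axis 1 1"
definition K3_z :: "'f::field ^ 3" where "K3_z = axis 2 1"
definition K3_w :: "'f::field ^ 3" where "K3_w = axis 3 1"

definition K3_even :: "('f::field ^ 3) set" where "K3_even = vec.span {K3_e}"
definition K3_odd :: "('f::field ^ 3) set" where "K3_odd = vec.span {K3_z, K3_w}"

text \<open>The bilinear extension of the multiplication table; the zero product of \<open>w\<close> with itself
  contributes no summand.\<close>

definition K3_mult :: "'f::field ^ 3 \<Rightarrow> 'f ^ 3 \<Rightarrow> 'f ^ 3" where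
  "K3_mult x y =
     (x $ 1 * y $ 1) *s K3_e
   + (x $ 1 * y $ 2) *s ((1/2) *s K3_z + (1/2) *s K3_w)
   + (x $ 1 * y $ 3) *s ((1/2) *s K3_w)
   + (x $ 2 * y $ 1) *s ((1/2) *s K3_z - (1/2) *s K3_w)
   + (x $ 3 * y $ 1) *s ((1/2) *s K3_w)
   + (x $ 2 * y $ 2) *s (- K3_e)
   + (x $ 2 * y $ 3) *s K3_e
   + (x $ 3 * y $ 2) *s (- K3_e)"

definition K3_subalgebra :: "('f::field ^ 3) set \<Rightarrow> bool" where
  "K3_subalgebra M \<longleftrightarrow> vec.subspace M \<and> (\<forall>x\<in>M. \<forall>y\<in>M. K3_mult x y \<in> M)"

lemma K3_basis_nth [simp]:
  "(K3_e :: 'f::field ^ 3) $ 1 = 1" "(K3_e :: 'f ^ 3) $ 2 = 0" "(K3_e :: 'f ^ 3) $ 3 = 0"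
  "(K3_z :: 'f ^ 3) $ 1 = 0" "(K3_z :: 'f ^ 3) $ 2 = 1" "(K3_z :: 'f ^ 3) $ 3 = 0"
  "(K3_w :: 'f ^ 3) $ 1 = 0" "(K3_w :: 'f ^ 3) $ 2 = 0" "(K3_w :: 'f ^ 3) $ 3 = 1"
  by (simp_all add: K3_e_def K3_z_def K3_w_def axis_def)

lemma K3_expand:
  fixes x :: "'f::field ^ 3"
  shows "x = (x $ 1) *s K3_e + (x $ 2) *s K3_z + (x $ 3) *s K3_w"
  by (simp add: vec_eq_iff forall_3)

lemma K3_mult_table:
  "K3_mult K3_e K3_e = (K3_e :: 'f::field ^ 3)"
  "K3_mult K3_e K3_z = (1/2) *s K3_z + (1/2) *s (K3_w :: 'f ^ 3)"
  "K3_mult K3_e K3_w = (1/2) *s (K3_w :: 'f ^ 3)"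
  "K3_mult K3_z K3_e = (1/2) *s K3_z - (1/2) *s (K3_w :: 'f ^ 3)"
  "K3_mult K3_w K3_e = (1/2) *s (K3_w :: 'f ^ 3)"
  "K3_mult K3_z K3_z = - (K3_e :: 'f ^ 3)"
  "K3_mult K3_z K3_w = (K3_e :: 'f ^ 3)"
  "K3_mult K3_w K3_z = - (K3_e :: 'f ^ 3)"
  "K3_mult K3_w K3_w = (0 :: 'f ^ 3)"
  by (simp_all add: K3_mult_def vec_eq_iff)

lemma K3_mult_bilinear:
  fixes x y u :: "'f::field ^ 3"
  shows "K3_mult (x + y) u = K3_mult x u + K3_mult y u"
    and "K3_mult u (x + y) = K3_mult u x + K3_mult u y"
    and "K3_mult (c *s x) u = c *s K3_mult x u"
    and "K3_mult u (c *s x) = c *s K3_mult u x"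
  by (simp_all add: K3_mult_def vec_eq_iff algebra_simps)

lemma K3_even_iff: "x \<in> K3_even \<longleftrightarrow> x $ 2 = 0 \<and> x $ 3 = 0"
  by (auto simp: K3_even_def vec.span_singleton vec_eq_iff forall_3)

lemma K3_odd_iff: "x \<in> K3_odd \<longleftrightarrow> x $ 1 = 0"
  by (auto simp: K3_odd_def vec.span_insert vec.span_singleton vec_eq_iff forall_3)

lemma K3_superalgebra_grading:
  "x \<in> K3_even \<Longrightarrow> y \<in> K3_even \<Longrightarrow> K3_mult x y \<in> K3_even"
  "x \<in> K3_even \<Longrightarrow> y \<in> K3_odd \<Longrightarrow> K3_mult x y \<in> K3_odd"
  "x \<in> K3_odd \<Longrightarrow> y \<in> K3_even \<Longrightarrow> K3_mult x y \<in> K3_odd"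
  "x \<in> K3_odd \<Longrightarrow> y \<in> K3_odd \<Longrightarrow> K3_mult x y \<in> K3_even"
  "K3_even \<inter> K3_odd = {0 :: 'f::field ^ 3}"
  "\<exists>a\<in>K3_even. \<exists>b\<in>K3_odd. (v :: 'f ^ 3) = a + b"
proof -
  show "\<exists>a\<in>K3_even. \<exists>b\<in>K3_odd. v = a + b"
    by (rule bexI[of _ "(v $ 1) *s K3_e"], rule bexI[of _ "(v $ 2) *s K3_z + (v $ 3) *s K3_w"])
       (auto simp: K3_even_iff K3_odd_iff vec_eq_iff forall_3)
qed (auto simp: K3_even_iff K3_odd_iff K3_mult_def vec_eq_iff forall_3)

end

theory Submission
  imports Defs
begin

text \<open>
  For \<open>x = a e + b z + c w\<close> one has \<open>x\<^sup>2 = a x - b\<^sup>2 e\<close> and \<open>e x - x e = b w\<close>. Hence a subalgebra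
  containing some \<open>x\<close> with \<open>b \<noteq> 0\<close> contains \<open>e\<close>, then \<open>w\<close>, then \<open>z\<close>, and is the whole algebra.
  Every proper subalgebra therefore lies in the span of \<open>e\<close> and \<open>w\<close>.
\<close>

text \<open>In the square the contributions of \<open>zw\<close> and \<open>wz\<close> cancel and
  \<open>ww\<close> vanishes, while \<open>ez + ze = z\<close> and \<open>ew + we = w\<close>; so
  only \<open>zz = -e\<close> keeps \<open>x\<close> from being an eigenvector of its own
  multiplication.\<close>

lemma K3_mult_self:
  fixes x :: "'f::field_char_0 ^ 3"
  shows "K3_mult x x = (x $ 1) *s x - ((x $ 2) ^ 2) *s K3_e"
  by (simp add: K3_mult_def vec_eq_iff forall_3 power2_eq_square)

text \<open>\<open>e\<close> commutes with \<open>w\<close>, and \<open>ez - ze = w\<close>, so the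
  commutator sees only the \<open>z\<close>-coordinate.\<close>

lemma K3_commutator_e:
  fixes x :: "'f::field_char_0 ^ 3"
  shows "K3_mult K3_e x - K3_mult x K3_e = (x $ 2) *s K3_w"
  by (simp add: K3_mult_def vec_eq_iff forall_3)

lemma K3_span_e_w_iff:
  fixes x :: "'f::field ^ 3"
  shows "x \<in> vec.span {K3_e, K3_w} \<longleftrightarrow> x $ 2 = 0"
  by (auto simp: vec.span_insert vec.span_singleton vec_eq_iff forall_3)

lemma vec_subspace_scale_cancel:
  assumes "vec.subspace M" "c *s x \<in> M" "c \<noteq> 0"
  shows "x \<in> M"
  using vec.subspace_scale[OF assms(1,2), of "inverse c"] assms(3) by simp

lemma K3_subalgebra_eq_UNIV:
  fixes M :: "('f::field_char_0 ^ 3) set"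
  assumes M: "K3_subalgebra M" and x: "x \<in> M" "x $ 2 \<noteq> 0"
  shows "M = UNIV"
proof -
  have sub: "vec.subspace M" and mult: "\<And>u v. u \<in> M \<Longrightarrow> v \<in> M \<Longrightarrow> K3_mult u v \<in> M"
    using M by (auto simp: K3_subalgebra_def)
  have "(x $ 1) *s x - K3_mult x x \<in> M"
    by (rule vec.subspace_diff[OF sub vec.subspace_scale[OF sub x(1)] mult[OF x(1) x(1)]])
  then have "((x $ 2) ^ 2) *s K3_e \<in> M"
    by (simp add: K3_mult_self)
  then have e: "K3_e \<in> M"
    by (rule vec_subspace_scale_cancel[OF sub]) (use x(2) in simp)
  have "(x $ 2) *s K3_w \<in> M"
    using vec.subspace_diff[OF sub mult[OF e x(1)] mult[OF x(1) e]] K3_commutator_e[of x] by simp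
  then have w: "K3_w \<in> M"
    using x(2) by (rule vec_subspace_scale_cancel[OF sub])
  have "x - (x $ 1) *s K3_e - (x $ 3) *s K3_w \<in> M"
    by (rule vec.subspace_diff[OF sub vec.subspace_diff[OF sub x(1)]])
       (rule vec.subspace_scale[OF sub e] vec.subspace_scale[OF sub w])+
  also have "x - (x $ 1) *s K3_e - (x $ 3) *s K3_w = (x $ 2) *s K3_z"
    by (simp add: vec_eq_iff forall_3)
  finally have z: "K3_z \<in> M"
    using x(2) by (rule vec_subspace_scale_cancel[OF sub])
  have "y \<in> M" for y
    using vec.subspace_add[OF sub vec.subspace_add[OF sub vec.subspace_scale[OF sub e]
        vec.subspace_scale[OF sub z]] vec.subspace_scale[OF sub w]]
    by (metis K3_expand)
  then show ?thesis by auto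
qed

lemma K3_proper_subalgebra_subset:
  fixes M :: "('f::field_char_0 ^ 3) set"
  assumes "K3_subalgebra M" "vec.dim M < 3"
  shows "M \<subseteq> vec.span {K3_e, K3_w}"
proof
  fix x assume "x \<in> M"
  moreover have "M \<noteq> UNIV"
    \<comment> \<open>The whole space has dimension \<open>card cart_basis\<close>, which is
      3.\<close>
    using assms(2) by (auto simp: card_cart_basis)
  ultimately show "x \<in> vec.span {K3_e, K3_w}"
    using K3_subalgebra_eq_UNIV[OF assms(1)] by (auto simp: K3_span_e_w_iff)
qed

theorem theorem6:
  fixes M :: "('f::field_char_0 ^ 3) set"
  assumes "K3_subalgebra M"
  shows "(vec.dim M = 1 \<longrightarrow> (\<exists>\<gamma>\<^sub>1 \<gamma>\<^sub>2. M = vec.span {\<gamma>\<^sub>1 *s K3_e + \<gamma>\<^sub>2 *s K3_w}))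
       \<and> (vec.dim M = 2 \<longrightarrow> M = vec.span {K3_e, K3_w})"
proof (intro conjI impI)
  have sub: "vec.subspace M"
    using assms by (simp add: K3_subalgebra_def)
  {
    assume dim: "vec.dim M = 1"
    obtain B where B: "B \<subseteq> M" "M \<subseteq> vec.span B" "card B = vec.dim M"
      by (rule vec.basis_exists)
    then obtain v where v: "B = {v}"
      using dim by (auto simp: card_1_singleton_iff)
    \<comment> \<open>The basis vector lies in the span of \<open>e\<close> and \<open>w\<close>, so
      its first and third coordinates serve as the two scalars.\<close>
    have "v $ 2 = 0"
      using K3_proper_subalgebra_subset[OF assms] dim B(1) v by (auto simp: K3_span_e_w_iff)
    then have "v = (v $ 1) *s K3_e + (v $ 3) *s K3_w"
      by (simp add: vec_eq_iff forall_3)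
    moreover have "M = vec.span {v}"
      using B(1,2) vec.span_minimal[OF B(1) sub] unfolding v by (intro equalityI)
    ultimately show "\<exists>\<gamma>\<^sub>1 \<gamma>\<^sub>2. M = vec.span {\<gamma>\<^sub>1 *s K3_e + \<gamma>\<^sub>2 *s K3_w}"
      by metis
  next
    assume dim: "vec.dim M = 2"
    \<comment> \<open>\<open>M\<close> already lies in this span, so equality follows once the
      dimension of the span is at most that of \<open>M\<close>; counting generators gives this
      bound.\<close>
    have "vec.dim (vec.span {K3_e, K3_w :: 'f ^ 3}) \<le> card {K3_e, K3_w :: 'f ^ 3}"
      unfolding vec.dim_span by (rule vec.dim_le_card') simp
    also have "\<dots> \<le> vec.dim M"
      using dim by (simp add: card_insert_if)
    finally show "M = vec.span {K3_e, K3_w}"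
      using K3_proper_subalgebra_subset[OF assms] dim
      by (intro vec.subspace_dim_equal sub vec.subspace_span) auto
  }
qed

end
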